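(* Let $T:X\to X$ be a non-singular measurable transformation and $u:X\to\mathbb C$ a measurable function, not a.e. zero, such that $W_{u,T}$ is a bounded operator on $L(p,q)$. If $\mu(T(A))\le\mu(A)$ for each $A\in\mathcal A$ and $X_k^c=X\setminus X_k\subseteq T^{k+1}(X_k^c)$ (containment up to a $\mu$-null set) for some $k\in\mathbb N\cup\{0\}$, then the measures $\mu_k$ and $\mu_{k+1}$ are equivalent. In fact, $\mu_m\ll\mu_k\ll\mu_m$ for all $m\ge k$.
   Context: $(X,\mathcal A,\mu)$ is a $\sigma$-finite complete measure space. For measurable $h:X\to\mathbb C$ put $\mu_h(s)=\mu(\{x\in X:|h(x)|>s\})$ for $s\ge 0$, $h^*(t)=\inf\{s>0:\mu_h(s)\le t\}$ and $h^{**}(t)=\frac1t\int_0^t h^*(s)\,ds$ for $t>0$. The Lorentz space $L(p,q)$ (for $1<p<\infty$, $1\le q<\infty$, or $1<p\le\infty$, $q=\infty$) is the Banach space of (a.e.-equivalence classes of) measurable $h:X\to\mathbb C$ with $\|h\|_{pq}<\infty$, where $\|h\|_{pq}=\left(\frac qp\int_0^\infty (t^{1/p}h^{**}(t))^q\frac{dt}{t}\right)^{1/q}$ if $1<p<\infty$, $1\le q<\infty$, and $\|h\|_{pq}=\sup_{t>0}t^{1/p}h^{**}(t)$ if $1<p\le\infty$, $q=\infty$. A measurable transformation $T:X\to X$ is non-singular if $\mu(A)=0$ implies $\mu(T^{-1}(A))=0$. For $k\ge 0$, $\mu_k(A)=\mu(T^{-k}(A))$ (so $\mu_0=\mu$),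 and $h_{T^k}\ge 0$ is the (locally integrable) Radon–Nikodym derivative: $\mu_k(A)=\int_A h_{T^k}\,d\mu$ for $A\in\mathcal A$. $X_k=\{x\in X:h_{T^k}(x)=0\}$. The containment $X_k^c\subseteq T^{k+1}(X_k^c)$ means $\mu(X_k^c\setminus T^{k+1}(X_k^c))=0$. The hypothesis $\mu(T(A))\le\mu(A)$ for $A\in\mathcal A$ includes that $T(A)\in\mathcal A$. $W_{u,T}f=(u\circ T)\cdot(f\circ T)$. Two measures are equivalent if each is absolutely continuous with respect to the other. *)

theory Defs
  imports "HOL-Analysis.Analysis"
begin

text \<open>The functionals below take values in \<^typ>\<open>ennreal\<close>, so that no finiteness or integrability has to
  be presupposed.\<close>

definition distribution_fn :: "'a measure \<Rightarrow> ('a \<Rightarrow> complex) \<Rightarrow> real \<Rightarrow> ennreal" where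
  "distribution_fn M h s = emeasure M {x \<in> space M. cmod (h x) > s}"

text \<open>The infimum of the empty set is \<open>\<infinity>\<close>.\<close>

definition rearrangement :: "'a measure \<Rightarrow> ('a \<Rightarrow> complex) \<Rightarrow> real \<Rightarrow> ennreal" where
  "rearrangement M h t = Inf {ennreal s |s. s > 0 \<and> distribution_fn M h s \<le> ennreal t}"

definition maximal_rearrangement :: "'a measure \<Rightarrow> ('a \<Rightarrow> complex) \<Rightarrow> real \<Rightarrow> ennreal" where
  "maximal_rearrangement M h t =
     ennreal (1 / t) * (\<integral>\<^sup>+ s \<in> {0<..<t}. rearrangement M h s \<partial>lborel)"

text \<open>Only used for exponents \<open>r > 0\<close>.\<close>

definition ennreal_powr :: "ennreal \<Rightarrow> real \<Rightarrow> ennreal" where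
  "ennreal_powr x r = (if x = \<infinity> then \<infinity> else ennreal (enn2real x powr r))"

definition lorentz_exponents :: "ennreal \<Rightarrow> ennreal \<Rightarrow> bool" where
  "lorentz_exponents p q \<longleftrightarrow> (1 < p \<and> p < \<infinity> \<and> 1 \<le> q \<and> q < \<infinity>) \<or> (1 < p \<and> q = \<infinity>)"

text \<open>For \<open>p = \<infinity>\<close> the exponent \<open>1 / p\<close> is \<open>0\<close>.\<close>

definition lorentz_norm :: "'a measure \<Rightarrow> ennreal \<Rightarrow> ennreal \<Rightarrow> ('a \<Rightarrow> complex) \<Rightarrow> ennreal" where
  "lorentz_norm M p q h =
     (if q < \<infinity>
      then ennreal_powr
             (q / p * (\<integral>\<^sup>+ t \<in> {0<..}.
                 ennreal_powr (ennreal (t powr enn2real (1 / p)) * maximal_rearrangement M h t)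
                   (enn2real q) * ennreal (1 / t) \<partial>lborel))
             (enn2real (1 / q))
      else (SUP t \<in> {0<..}. ennreal (t powr enn2real (1 / p)) * maximal_rearrangement M h t))"

text \<open>Elements are functions rather than a.e.-equivalence classes; the norm is invariant under
  modification on null sets.\<close>

definition lorentz_space :: "'a measure \<Rightarrow> ennreal \<Rightarrow> ennreal \<Rightarrow> ('a \<Rightarrow> complex) set" where
  "lorentz_space M p q = {h \<in> borel_measurable M. lorentz_norm M p q h < \<infinity>}"

definition nonsingular :: "'a measure \<Rightarrow> ('a \<Rightarrow> 'a) \<Rightarrow> bool" where
  "nonsingular M T \<longleftrightarrow> T \<in> measurable M M \<and>
     (\<forall>A \<in> sets M. emeasure M A = 0 \<longrightarrow> emeasure M (T -` A \<inter> space M) = 0)"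

definition weighted_comp :: "('a \<Rightarrow> complex) \<Rightarrow> ('a \<Rightarrow> 'a) \<Rightarrow> ('a \<Rightarrow> complex) \<Rightarrow> 'a \<Rightarrow> complex" where
  "weighted_comp u T f = (\<lambda>x. (u \<circ> T) x * (f \<circ> T) x)"

text \<open>Linearity, and compatibility with a.e. equality, are automatic for the operators
  \<^const>\<open>weighted_comp\<close> with \<open>T\<close> non-singular, and are therefore not part of the definition.\<close>

definition bounded_on_lorentz ::
  "'a measure \<Rightarrow> ennreal \<Rightarrow> ennreal \<Rightarrow> (('a \<Rightarrow> complex) \<Rightarrow> 'a \<Rightarrow> complex) \<Rightarrow> bool" where
  "bounded_on_lorentz M p q W \<longleftrightarrow>
     (\<exists>C::real. \<forall>f \<in> lorentz_space M p q. W f \<in> lorentz_space M p q \<and>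
        lorentz_norm M p q (W f) \<le> ennreal C * lorentz_norm M p q f)"

definition iter_measure :: "'a measure \<Rightarrow> ('a \<Rightarrow> 'a) \<Rightarrow> nat \<Rightarrow> 'a measure" where
  "iter_measure M T k = distr M M (T ^^ k)"

text \<open>\<^const>\<open>RN_deriv\<close> is \<^typ>\<open>ennreal\<close>-valued: over a \<open>\<sigma>\<close>-finite \<open>M\<close> it is a density of
  \<open>\<mu>\<^sub>k\<close> also when \<open>\<mu>\<^sub>k\<close> is not \<open>\<sigma>\<close>-finite.\<close>

definition RN_zero_set :: "'a measure \<Rightarrow> ('a \<Rightarrow> 'a) \<Rightarrow> nat \<Rightarrow> 'a set" where
  "RN_zero_set M T k = {x \<in> space M. RN_deriv M (iter_measure M T k) x = 0}"

text \<open>\<^term>\<open>absolutely_continuous M N\<close> means \<open>N \<lless> M\<close>.\<close>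

definition equivalent_measures :: "'a measure \<Rightarrow> 'a measure \<Rightarrow> bool" where
  "equivalent_measures M N \<longleftrightarrow> absolutely_continuous M N \<and> absolutely_continuous N M"

end

theory Submission
  imports Defs
begin

text \<open>Non-singularity yields \<open>\<mu>\<^sub>m \<lless> \<mu>\<^sub>k\<close> for \<open>m \<ge> k\<close>. Conversely, if
  the preimage of \<open>A\<close> under \<open>T\<^sup>k\<^sup>+\<^sup>1\<close> is null then so is the image of that preimage, since \<open>T\<close> does
  not increase measure; this image is the part of \<open>A\<close> in the range of \<open>T\<^sup>k\<^sup>+\<^sup>1\<close>, which contains almost all of the set where
  the density of \<open>\<mu>\<^sub>k\<close> is positive. Hence \<open>\<mu>\<^sub>k(A) = 0\<close>. Pulling back along \<open>T\<close> transfers this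
  from \<open>k, k+1\<close> to \<open>k+1, k+2\<close>, and so on.\<close>

lemma sets_iter_measure [simp]: "sets (iter_measure M T k) = sets M"
  by (simp add: iter_measure_def)

lemma measurable_funpow: "T \<in> measurable M M \<Longrightarrow> T ^^ n \<in> measurable M M"
  by (induction n) (auto intro: measurable_comp simp: id_def)

lemma null_sets_iter_measure_iff:
  assumes "T \<in> measurable M M"
  shows "A \<in> null_sets (iter_measure M T k) \<longleftrightarrow>
    A \<in> sets M \<and> (T ^^ k) -` A \<inter> space M \<in> null_sets M"
  using null_sets_distr_iff[OF measurable_funpow[OF assms, of k]]
  by (auto simp: iter_measure_def)

text \<open>The outermost factor of \<open>T ^^ Suc k\<close> is split off, so that a null-set
  inclusion between two of these measures can be pulled back along \<open>T\<close>.\<close>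

lemma null_sets_iter_measure_Suc_iff:
  assumes "T \<in> measurable M M"
  shows "A \<in> null_sets (iter_measure M T (Suc k)) \<longleftrightarrow>
    A \<in> sets M \<and> T -` A \<inter> space M \<in> null_sets (iter_measure M T k)"
proof -
  have "(T ^^ Suc k) -` A \<inter> space M = (T ^^ k) -` (T -` A \<inter> space M) \<inter> space M"
    using measurable_space[OF measurable_funpow[OF assms, of k]] by auto
  then show ?thesis
    using assms by (auto simp: null_sets_iter_measure_iff measurable_sets)
qed

lemma nonsingular_vimage_null:
  assumes "nonsingular M T" "A \<in> null_sets M"
  shows "T -` A \<inter> space M \<in> null_sets M"
  using assms unfolding nonsingular_def by (auto intro: measurable_sets)

lemma nonsingular_iter_measure_le:
  assumes "nonsingular M T" "k \<le> m"
  shows "absolutely_continuous (iter_measure M T k) (iter_measure M T m)"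
  using assms(2)
proof (induction m rule: dec_induct)
  case base
  then show ?case by (simp add: absolutely_continuous_def)
next
  case (step n)
  have T: "T \<in> measurable M M" using assms(1) by (simp add: nonsingular_def)
  have "A \<in> null_sets (iter_measure M T (Suc n))"
    if "A \<in> null_sets (iter_measure M T n)" for A
  proof -
    \<comment> \<open>Here the innermost factor is split off instead, since non-singularity speaks
      about preimages of \<open>M\<close>-null sets.\<close>
    have "(T ^^ Suc n) -` A \<inter> space M = T -` ((T ^^ n) -` A \<inter> space M) \<inter> space M"
      using measurable_space[OF T] by (auto simp: funpow_swap1)
    moreover have "T -` ((T ^^ n) -` A \<inter> space M) \<inter> space M \<in> null_sets M"
      using that by (intro nonsingular_vimage_null[OF assms(1)]) (simp add: null_sets_iter_measure_iff[OF T])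
    ultimately show ?thesis
      using that by (simp only: null_sets_iter_measure_iff[OF T])
  qed
  with step.IH show ?case by (auto simp: absolutely_continuous_def)
qed

lemma funpow_image_closed:
  assumes "\<And>A. A \<in> \<S> \<Longrightarrow> T ` A \<in> \<S>" "A \<in> \<S>"
  shows "(T ^^ n) ` A \<in> \<S>"
proof (induction n)
  case (Suc n)
  then show ?case
    using assms(1)[OF Suc] by (simp add: image_image)
qed (use assms(2) in simp)

text \<open>Absolute continuity makes the Radon-Nikodym derivative a density of the iterated
  measure, and this density vanishes a.e. on \<open>A\<close>.\<close>

lemma iter_measure_null_if_null_on_support:
  assumes "sigma_finite_measure M" "absolutely_continuous M (iter_measure M T k)"
    and "A \<in> sets M" "A \<inter> (space M - RN_zero_set M T k) \<in> null_sets M"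
  shows "A \<in> null_sets (iter_measure M T k)"
proof -
  interpret sigma_finite_measure M by fact
  let ?h = "RN_deriv M (iter_measure M T k)"
  have "AE x in M. x \<in> A \<longrightarrow> ?h x = 0"
    using AE_not_in[OF assms(4)] AE_space by eventually_elim (auto simp: RN_zero_set_def)
  then have "A \<in> null_sets (density M ?h)"
    using assms(3) by (simp add: null_sets_density_iff)
  then show ?thesis
    using density_RN_deriv[OF assms(2)] by simp
qed

lemma iter_measure_absolutely_continuous_Suc:
  assumes "sigma_finite_measure M" "nonsingular M T"
    and image_null: "\<And>A. A \<in> null_sets M \<Longrightarrow> T ` A \<in> null_sets M"
    and support: "(space M - RN_zero_set M T k) - (T ^^ Suc k) ` (space M - RN_zero_set M T k) \<in> null_sets M"
  shows "absolutely_continuous (iter_measure M T (Suc k)) (iter_measure M T k)"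
  unfolding absolutely_continuous_def
proof
  let ?S = "space M - RN_zero_set M T k"
  have T: "T \<in> measurable M M" using assms(2) by (simp add: nonsingular_def)
  \<comment> \<open>\<open>T ^^ 0\<close> is the identity; comparing indices 0 and \<open>k\<close>
    then gives the absolute continuity with respect to \<open>M\<close> that Radon-Nikodym
    requires.\<close>
  have "null_sets (iter_measure M T 0) = null_sets M"
    by (auto simp: null_sets_iter_measure_iff[OF T] sets.Int_space_eq2)
  then have ac: "absolutely_continuous M (iter_measure M T k)"
    using nonsingular_iter_measure_le[OF assms(2), of 0 k] by (simp add: absolutely_continuous_def)
  have S: "?S \<in> sets M" by (simp add: RN_zero_set_def)
  fix A assume "A \<in> null_sets (iter_measure M T (Suc k))"
  then have A: "A \<in> sets M" and "(T ^^ Suc k) -` A \<inter> space M \<in> null_sets M"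
    unfolding null_sets_iter_measure_iff[OF T] by auto
  then have "(T ^^ Suc k) ` ((T ^^ Suc k) -` A \<inter> space M) \<union> (?S - (T ^^ Suc k) ` ?S)
      \<in> null_sets M"
    using support by (intro null_sets.Un funpow_image_closed[OF image_null])
  \<comment> \<open>A point of \<open>A \<inter> ?S\<close> outside the exceptional set is the image
    of some point of \<open>?S\<close>, which lies in the preimage of \<open>A\<close>.\<close>
  moreover have "A \<inter> ?S \<subseteq> (T ^^ Suc k) ` ((T ^^ Suc k) -` A \<inter> space M) \<union> (?S - (T ^^ Suc k) ` ?S)"
    by (auto simp del: funpow.simps)
  ultimately have "A \<inter> ?S \<in> null_sets M"
    using A S by (auto intro: null_sets_subset simp del: funpow.simps)
  then show "A \<in> null_sets (iter_measure M T k)"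
    by (rule iter_measure_null_if_null_on_support[OF assms(1) ac A])
qed

lemma iter_measure_absolutely_continuous_ge:
  assumes T: "T \<in> measurable M M"
    and "absolutely_continuous (iter_measure M T (Suc k)) (iter_measure M T k)" "k \<le> m"
  shows "absolutely_continuous (iter_measure M T m) (iter_measure M T k)"
proof -
  have Suc_step: "absolutely_continuous (iter_measure M T (Suc n)) (iter_measure M T n)" if "k \<le> n" for n
    using that
  proof (induction n rule: dec_induct)
    case base
    show ?case by (fact assms(2))
  next
    case (step n)
    \<comment> \<open>If \<open>A\<close> is null at index \<open>n + 2\<close>, then its preimage
      under \<open>T\<close> is null at \<open>n + 1\<close>, hence at \<open>n\<close> by
      induction, so \<open>A\<close> is null at \<open>n + 1\<close>.\<close>
    then show ?case
      unfolding absolutely_continuous_def subset_iff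
      using null_sets_iter_measure_Suc_iff[OF T] by metis
  qed
  show ?thesis
    using assms(3)
  proof (induction m rule: dec_induct)
    case base
    show ?case by (simp add: absolutely_continuous_def)
  next
    \<comment> \<open>Transitivity: the one-step relations are chained from \<open>m\<close> down to
      \<open>k\<close>.\<close>
    case (step n)
    with Suc_step[of n] show ?case by (auto simp: absolutely_continuous_def)
  qed
qed

theorem theorem4p10:
  fixes M :: "'a measure" and T :: "'a \<Rightarrow> 'a" and u :: "'a \<Rightarrow> complex"
    and p q :: ennreal and k :: nat
  assumes "sigma_finite_measure M" and "complete_measure M"
    and "lorentz_exponents p q"
    and "nonsingular M T"
    and "u \<in> borel_measurable M"
    and "\<not> (AE x in M. u x = 0)"
    and "bounded_on_lorentz M p q (weighted_comp u T)"
    and "\<And>A. A \<in> sets M \<Longrightarrow> T ` A \<in> sets M \<and> emeasure M (T ` A) \<le> emeasure M A"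
    and "(space M - RN_zero_set M T k) - (T ^^ (k + 1)) ` (space M - RN_zero_set M T k) \<in> null_sets M"
  shows "equivalent_measures (iter_measure M T k) (iter_measure M T (k + 1))
    \<and> (\<forall>m\<ge>k. absolutely_continuous (iter_measure M T k) (iter_measure M T m)
            \<and> absolutely_continuous (iter_measure M T m) (iter_measure M T k))"
proof -
  have T: "T \<in> measurable M M" using assms(4) by (simp add: nonsingular_def)
  have image_null: "T ` A \<in> null_sets M" if "A \<in> null_sets M" for A
    using assms(8)[OF null_setsD2[OF that]] null_setsD1[OF that] by auto
  have "absolutely_continuous (iter_measure M T (Suc k)) (iter_measure M T k)"
    using iter_measure_absolutely_continuous_Suc[OF assms(1,4) image_null, of k] assms(9)
    by (simp only: Suc_eq_plus1)
  then have "\<forall>m\<ge>k. absolutely_continuous (iter_measure M T k) (iter_measure M T m)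
      \<and> absolutely_continuous (iter_measure M T m) (iter_measure M T k)"
    using iter_measure_absolutely_continuous_ge[OF T] nonsingular_iter_measure_le[OF assms(4)] by blast
  \<comment> \<open>Equivalence is the instance \<open>m = k + 1\<close>.\<close>
  then show ?thesis by (simp add: equivalent_measures_def)
qed

end
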